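(* Let $s\in\mathbb{C}$ with $0<\operatorname{Re}(s)<1$, let $x>0$, let $k\ge 0$ be an integer, and let $0<R<x$. Then \[ \frac{\left|\frac{\partial^k}{\partial x^k}G(s,x)\right|}{k!}\le \frac{e^{R-x}}{(x-R)R^k}, \] where $G(s,x)=\int_1^\infty e^{-xy}\,y^{s}\,\frac{dy}{y}$.
   Context: For $\operatorname{Re}(w)>0$ and $s\in\mathbb{C}$ define $G(s,w)=\int_1^\infty e^{-wy}y^{s}\,\frac{dy}{y}$ (for real $w=x>0$ this equals $x^{-s}\Gamma(s,x)$, with $\Gamma(s,x)$ the upper incomplete Gamma function); it is holomorphic in $w$ on $\operatorname{Re}(w)>0$, and the derivatives are taken in the second variable. *)

theory Defs
  imports "HOL-Complex_Analysis.Complex_Analysis"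
begin

text \<open>
  Meaningful for \<open>Re w > 0\<close>, where the integrand is absolutely integrable; elsewhere the value
  is whatever the Bochner integral returns.
\<close>

definition G :: "complex \<Rightarrow> complex \<Rightarrow> complex" where
  "G s w = (LINT y:{1..}|lborel. exp (- w * complex_of_real y) * complex_of_real y powr s
                                   / complex_of_real y)"

end

theory Submission
  imports Defs
begin

text \<open>
  For \<open>Re s \<le> 1\<close> and \<open>y \<ge> 1\<close> the integrand is dominated by \<open>exp (- Re w * y)\<close>. Hence the
  truncated integrals over \<open>{1..n}\<close> converge to \<open>G s\<close> locally uniformly, so \<open>G s\<close> is holomorphic
  on the right half-plane and satisfies \<open>cmod (G s w) \<le> exp (- Re w) / Re w\<close> there. The claim is
  Cauchy's inequality on the circle of radius \<open>R\<close> around \<open>x\<close>, on which \<open>Re w \<ge> x - R\<close>.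
\<close>

lemma set_integrable_exp_minus_atLeast:
  fixes a c :: real
  assumes "c > 0"
  shows "set_integrable lborel {a..} (\<lambda>y. exp (- c * y))"
    and "(LINT y:{a..}|lborel. exp (- c * y)) = exp (- c * a) / c"
proof -
  have I: "((\<lambda>y. exp (- c * y)) has_integral exp (- c * a) / c) {a..}"
    using has_integral_exp_minus_to_infinity[OF assms] .
  then have "(\<lambda>y. exp (- c * y)) absolutely_integrable_on {a..}"
    by (intro nonnegative_absolutely_integrable_1) auto
  then show S: "set_integrable lborel {a..} (\<lambda>y. exp (- c * y))"
    \<comment> \<open>Absolute integrability refers to \<open>lebesgue\<close>, the completion of
      \<open>lborel\<close>; for a Borel measurable integrand it descends to
      \<open>lborel\<close>.\<close>
    unfolding set_integrable_def by (subst (asm) integrable_completion) auto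
  show "(LINT y:{a..}|lborel. exp (- c * y)) = exp (- c * a) / c"
    using set_borel_integral_eq_integral(2)[OF S] I by (simp add: integral_unique)
qed

definition G_integrand :: "complex \<Rightarrow> complex \<Rightarrow> real \<Rightarrow> complex" where
  "G_integrand s w y = exp (- w * of_real y) * of_real y powr s / of_real y"

lemma G_eq: "G s w = (LINT y:{1..}|lborel. G_integrand s w y)"
  by (simp add: G_def G_integrand_def)

lemma norm_G_integrand_le:
  assumes "Re s \<le> 1" "y \<ge> 1"
  shows "cmod (G_integrand s w y) \<le> exp (- Re w * y)"
proof -
  have "y powr Re s \<le> y powr 1"
    using assms by (intro powr_mono) auto
  then have "y powr Re s / y \<le> 1"
    using assms by simp
  moreover have "cmod (G_integrand s w y) = exp (- Re w * y) * (y powr Re s / y)"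
    using assms by (simp add: G_integrand_def norm_mult norm_divide norm_powr_real_powr)
  ultimately show ?thesis
    using mult_left_le[of "y powr Re s / y" "exp (- Re w * y)"] by simp
qed

text \<open>Positivity of \<open>y\<close> keeps \<open>of_real y\<close> off the branch cut of
  \<open>powr\<close> and the denominator away from zero.\<close>

lemma continuous_on_G_integrand:
  assumes "\<And>y. y \<in> A \<Longrightarrow> y > 0"
  shows "continuous_on A (G_integrand s w)"
  unfolding G_integrand_def using assms
  by (intro continuous_intros) (fastforce simp: complex_nonpos_Reals_iff)+

lemma set_integrable_G_integrand:
  assumes "Re s \<le> 1" "Re w > 0" "A \<in> sets borel" "A \<subseteq> {1..}"
  shows "set_integrable lborel A (G_integrand s w)"
proof -
  have "set_integrable lborel {1..} (G_integrand s w)"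
  proof (rule set_integrable_bound)
    show "set_integrable lborel {1..} (\<lambda>y. exp (- Re w * y))"
      by (rule set_integrable_exp_minus_atLeast) fact
    show "set_borel_measurable lborel {1..} (G_integrand s w)"
      unfolding set_borel_measurable_def
      using borel_measurable_continuous_on_indicator[OF _ continuous_on_G_integrand[of "{1..}" s w]]
      by simp
    show "AE y in lborel. y \<in> {1..} \<longrightarrow> cmod (G_integrand s w y) \<le> norm (exp (- Re w * y))"
      using norm_G_integrand_le[OF assms(1)] by simp
  qed
  then show ?thesis
    by (rule set_integrable_subset) (use assms in auto)
qed

text \<open>Allowing any Borel set \<open>A\<close> inside \<open>{a..}\<close> lets one estimate
  serve twice: \<open>A = {1..}\<close> bounds \<open>G s w\<close> itself, and
  \<open>A = {b<..}\<close> bounds the error of truncating at \<open>b\<close>.\<close>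

lemma norm_integral_G_integrand_le:
  assumes "Re s \<le> 1" "Re w > 0" "A \<in> sets borel" "A \<subseteq> {a..}" "a \<ge> 1"
  shows "cmod (LINT y:A|lborel. G_integrand s w y) \<le> exp (- Re w * a) / Re w"
proof -
  have A: "A \<subseteq> {1..}"
    using assms by auto
  have int: "set_integrable lborel A (G_integrand s w)"
    using set_integrable_G_integrand[OF assms(1-3) A] .
  note exp_int = set_integrable_exp_minus_atLeast[OF assms(2), of a]
  have "cmod (LINT y:A|lborel. G_integrand s w y) \<le> (LINT y:A|lborel. cmod (G_integrand s w y))"
    by (rule set_integral_norm_bound[OF int])
  also have "\<dots> \<le> (LINT y:{a..}|lborel. exp (- Re w * y))"
    unfolding set_lebesgue_integral_def
  proof (rule integral_mono)
    show "integrable lborel (\<lambda>y. indicat_real A y *\<^sub>R cmod (G_integrand s w y))"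
      using set_integrable_norm[OF int] by (simp add: set_integrable_def)
    show "integrable lborel (\<lambda>y. indicat_real {a..} y *\<^sub>R exp (- Re w * y))"
      using exp_int(1) by (simp add: set_integrable_def)
    show "indicat_real A y *\<^sub>R cmod (G_integrand s w y) \<le> indicat_real {a..} y *\<^sub>R exp (- Re w * y)"
      for y
      using norm_G_integrand_le[OF assms(1), of y w] assms(4) A by (auto simp: indicator_def)
  qed
  also have "\<dots> = exp (- Re w * a) / Re w"
    by (rule exp_int(2))
  finally show ?thesis .
qed

lemma norm_G_le:
  assumes "Re s \<le> 1" "Re w > 0"
  shows "cmod (G s w) \<le> exp (- Re w) / Re w"
  using norm_integral_G_integrand_le[of s w "{1..}" 1] assms by (simp add: G_eq)

text \<open>Over a compact interval the \<open>w\<close>-derivative of the integrand is jointly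
  continuous, so the Leibniz rule applies to the Henstock-Kurzweil integral, which agrees with the
  Lebesgue integral here.\<close>

lemma holomorphic_truncated_G:
  assumes "Re s \<le> 1"
  shows "(\<lambda>w. LINT y:{1..b}|lborel. G_integrand s w y) holomorphic_on {w. Re w > 0}"
proof -
  have "(\<lambda>w. integral (cbox 1 b) (G_integrand s w)) holomorphic_on {w. Re w > 0}"
  proof (rule leibniz_rule_holomorphic)
    show "((\<lambda>w. G_integrand s w y) has_field_derivative (- of_real y * G_integrand s w y))
            (at w within {w. Re w > 0})" for w y
      unfolding G_integrand_def
      \<comment> \<open>The derivative is claimed for every real \<open>y\<close>; at
        \<open>y = 0\<close> division by zero makes both the integrand and its derivative vanish
        identically.\<close>
      by (cases "y = 0") (auto intro!: derivative_eq_intros simp: field_simps)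
    show "G_integrand s w integrable_on cbox 1 b" for w
      by (intro integrable_continuous continuous_on_G_integrand) auto
    show "continuous_on ({w. Re w > 0} \<times> cbox 1 b)
            (\<lambda>(w, y). - of_real y * G_integrand s w y)"
      unfolding G_integrand_def case_prod_unfold
      by (intro continuous_intros) (fastforce simp: complex_nonpos_Reals_iff)+
    show "convex {w. Re w > 0}"
      by (rule convex_halfspace_Re_gt)
  qed
  moreover have "integral (cbox 1 b) (G_integrand s w) = (LINT y:{1..b}|lborel. G_integrand s w y)"
    if "Re w > 0" for w
    using set_borel_integral_eq_integral(2)[OF set_integrable_G_integrand[OF assms that, of "{1..b}"]]
    by auto
  ultimately show ?thesis
    by (subst (asm) holomorphic_cong[OF refl]) auto
qed

text \<open>The difference is the tail integral over \<open>{b<..}\<close>. Its bound is uniform in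
  \<open>w\<close> wherever \<open>Re w\<close> stays above a positive constant.\<close>

lemma norm_G_minus_truncated_le:
  assumes "Re s \<le> 1" "Re w > 0" "b \<ge> 1"
  shows "cmod (G s w - (LINT y:{1..b}|lborel. G_integrand s w y)) \<le> exp (- Re w * b) / Re w"
proof -
  have "{1..} = {1..b} \<union> {b<..}"
    using assms by auto
  then have "G s w = (LINT y:{1..b} \<union> {b<..}|lborel. G_integrand s w y)"
    by (simp add: G_eq)
  also have "\<dots> = (LINT y:{1..b}|lborel. G_integrand s w y) + (LINT y:{b<..}|lborel. G_integrand s w y)"
    using assms by (intro set_integral_Un set_integrable_G_integrand) auto
  finally show ?thesis
    using norm_integral_G_integrand_le[of s w "{b<..}" b] assms by (simp add: subset_iff)
qed

lemma holomorphic_G: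
  assumes "Re s \<le> 1"
  shows "G s holomorphic_on {w. Re w > 0}"
proof (rule holomorphic_uniform_sequence)
  show "open {w. Re w > 0}"
    by (rule open_halfspace_Re_gt)
  \<comment> \<open>Using \<open>Suc n\<close> keeps the upper limit at least 1, as the truncation
    estimate requires.\<close>
  show "(\<lambda>w. LINT y:{1..real (Suc n)}|lborel. G_integrand s w y) holomorphic_on {w. Re w > 0}" for n
    using holomorphic_truncated_G[OF assms] .
  fix z :: complex
  assume "z \<in> {w. Re w > 0}"
  \<comment> \<open>With half the distance from \<open>z\<close> to the imaginary axis as radius,
    the same \<open>c\<close> bounds \<open>Re w\<close> from below on the closed ball.\<close>
  define c where "c = Re z / 2"
  have c: "c > 0"
    using \<open>z \<in> _\<close> by (simp add: c_def)
  have Re_ge: "Re w \<ge> c" if "w \<in> cball z c" for w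
    using that abs_Re_le_cmod[of "z - w"] by (auto simp: c_def dist_norm field_simps)
  have "uniform_limit (cball z c) (\<lambda>n w. LINT y:{1..real (Suc n)}|lborel. G_integrand s w y) (G s)
          sequentially"
  proof (rule uniform_limitI)
    fix e :: real
    assume "e > 0"
    have "(\<lambda>n. exp (- c * real (Suc n)) / c) \<longlonglongrightarrow> 0"
      using c by real_asymp
    then have "\<forall>\<^sub>F n in sequentially. exp (- c * real (Suc n)) / c < e"
      using \<open>e > 0\<close> by (rule order_tendstoD)
    then show "\<forall>\<^sub>F n in sequentially. \<forall>w\<in>cball z c.
                 dist (LINT y:{1..real (Suc n)}|lborel. G_integrand s w y) (G s w) < e"
    proof eventually_elim
      case (elim n)
      show ?case
      proof
        fix w assume "w \<in> cball z c"
        then have w: "Re w \<ge> c"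
          by (rule Re_ge)
        have "dist (LINT y:{1..real (Suc n)}|lborel. G_integrand s w y) (G s w)
                \<le> exp (- Re w * real (Suc n)) / Re w"
          using norm_G_minus_truncated_le[OF assms, of w "real (Suc n)"] w c
          by (simp add: dist_norm norm_minus_commute)
        \<comment> \<open>The bound decreases as \<open>Re w\<close> grows, so its value at
          \<open>c\<close> dominates the whole ball.\<close>
        also have "\<dots> \<le> exp (- c * real (Suc n)) / c"
          using w c by (intro frac_le) (auto intro!: mult_right_mono)
        finally show "dist (LINT y:{1..real (Suc n)}|lborel. G_integrand s w y) (G s w) < e"
          using elim by linarith
      qed
    qed
  qed
  then show "\<exists>d>0. cball z d \<subseteq> {w. Re w > 0} \<and>
      uniform_limit (cball z d) (\<lambda>n w. LINT y:{1..real (Suc n)}|lborel. G_integrand s w y) (G s)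
        sequentially"
    using c Re_ge by force
qed

theorem mainTheorem2:
  fixes s :: complex and x R :: real and k :: nat
  assumes "0 < Re s" and "Re s < 1"
    and "0 < x"
    and "0 < R" and "R < x"
  shows "cmod ((deriv ^^ k) (\<lambda>w. G s w) (complex_of_real x)) / fact k
           \<le> exp (R - x) / ((x - R) * R ^ k)"
proof -
  have Re_ge: "Re w \<ge> x - R" if "cmod (of_real x - w) \<le> R" for w
    using that abs_Re_le_cmod[of "of_real x - w"] by simp
  \<comment> \<open>Since \<open>R < x\<close>, the closed ball lies in the half-plane; this yields
    both holomorphy inside and continuity up to the circle for Cauchy's inequality.\<close>
  have hol: "G s holomorphic_on cball (of_real x) R"
    by (rule holomorphic_on_subset[OF holomorphic_G])
       (use assms Re_ge in \<open>force simp: dist_norm\<close>)+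
  have "cmod ((deriv ^^ k) (G s) (of_real x)) \<le> fact k * (exp (R - x) / (x - R)) / R ^ k"
  proof (rule Cauchy_inequality)
    show "G s holomorphic_on ball (of_real x) R"
      using hol holomorphic_on_subset ball_subset_cball by blast
    show "continuous_on (cball (of_real x) R) (G s)"
      using hol by (rule holomorphic_on_imp_continuous_on)
    show "cmod (G s w) \<le> exp (R - x) / (x - R)" if "cmod (of_real x - w) = R" for w
    proof -
      have w: "Re w \<ge> x - R"
        using that Re_ge by simp
      then have "cmod (G s w) \<le> exp (- Re w) / Re w"
        using assms by (intro norm_G_le) auto
      \<comment> \<open>The map sending \<open>t > 0\<close> to \<open>exp (- t) / t\<close> is
        decreasing, so the worst case is \<open>x - R\<close>, the leftmost point of the
        circle.\<close>
      also have "\<dots> \<le> exp (R - x) / (x - R)"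
        using w assms by (intro frac_le) auto
      finally show ?thesis .
    qed
  qed fact
  then show ?thesis
    using assms by (simp add: field_simps)
qed

end
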